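(* Let $a<b$ and $c<d$ be real numbers, let $\Delta=[a,b]\times[c,d]\subset\mathbb{R}^2$, and let $f:\Delta\to\mathbb{R}$ be a partial differentiable mapping on $\Delta$ whose mixed second partial derivative $\frac{\partial^2 f}{\partial t\partial s}$ exists on $\Delta$. If $\frac{\partial^2 f}{\partial t\partial s}$ is bounded, i.e. $$ \left\|\frac{\partial^2 f}{\partial t\partial s}\right\|_\infty=\sup_{(x,y)\in(a,b)\times(c,d)}\left|\frac{\partial^2 f}{\partial t\partial s}(x,y)\right|<\infty, $$ then $$ \begin{aligned} &\Bigg|\frac{f\left(a,\frac{c+d}{2}\right)+f\left(b,\frac{c+d}{2}\right)+4f\left(\frac{a+b}{2},\frac{c+d}{2}\right)+f\left(\frac{a+b}{2},c\right)+f\left(\frac{a+b}{2},d\right)}{9}\\ &\quad+\frac{f(a,c)+f(b,c)+f(a,d)+f(b,d)}{36}+\frac{1}{(b-a)(d-c)}\int_a^b\int_c^d f(x,y)\,dy\,dx-A\Bigg|\\ &\le \frac{25(b-a)(d-c)}{1296}\left\|\frac{\partial^2 f}{\partial t\partial s}\right\|_\infty, \end{aligned} $$ where $$ \begin{aligned} A={}&\frac{1}{6(b-a)}\int_a^b\left[f(x,c)+4f\left(x,\frac{c+d}{2}\right)+f(x,d)\right]dx\\ &+\frac{1}{6(d-c)}\int_c^d\left[f(a,y)+4f\left(\frac{a+b}{2},y\right)+f(b,y)\right]dy. \end{aligned} $$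
   Context: The notation $\frac{\partial^2 f}{\partial t\partial s}$ denotes the mixed second partial derivative of $f$, with $s$ standing for the second variable and $t$ for the first: it is the partial derivative with respect to the first variable of the partial derivative $\frac{\partial f}{\partial s}$ of $f$ with respect to the second variable. "Partial differentiable" means that the first-order partial derivatives of $f$ exist on $\Delta$ (one-sided at the boundary). *)

theory Defs
  imports "HOL-Analysis.Analysis"
begin

text \<open>
  A function on a rectangle \<open>S \<times> T\<close> is represented by a total function whose values
  outside \<open>S \<times> T\<close> are irrelevant: all derivatives are taken within \<open>S\<close> or \<open>T\<close>,
  hence one-sided at the boundary.  The point \<open>(t, s)\<close> has first variable \<open>t\<close> and second
  variable \<open>s\<close>.
\<close>

definition partial_differentiable_fst_on ::
    "real set \<Rightarrow> real set \<Rightarrow> (real \<times> real \<Rightarrow> real) \<Rightarrow> bool" where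
  "partial_differentiable_fst_on S T f \<longleftrightarrow>
     (\<forall>x\<in>S. \<forall>y\<in>T. (\<lambda>t. f (t, y)) differentiable (at x within S))"

definition partial_differentiable_snd_on ::
    "real set \<Rightarrow> real set \<Rightarrow> (real \<times> real \<Rightarrow> real) \<Rightarrow> bool" where
  "partial_differentiable_snd_on S T f \<longleftrightarrow>
     (\<forall>x\<in>S. \<forall>y\<in>T. (\<lambda>s. f (x, s)) differentiable (at y within T))"

definition partial_differentiable_on ::
    "real set \<Rightarrow> real set \<Rightarrow> (real \<times> real \<Rightarrow> real) \<Rightarrow> bool" where
  "partial_differentiable_on S T f \<longleftrightarrow>
     partial_differentiable_fst_on S T f \<and> partial_differentiable_snd_on S T f"

definition partial_fst :: "real set \<Rightarrow> (real \<times> real \<Rightarrow> real) \<Rightarrow> real \<times> real \<Rightarrow> real" where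
  "partial_fst S f = (\<lambda>(x, y). vector_derivative (\<lambda>t. f (t, y)) (at x within S))"

definition partial_snd :: "real set \<Rightarrow> (real \<times> real \<Rightarrow> real) \<Rightarrow> real \<times> real \<Rightarrow> real" where
  "partial_snd T f = (\<lambda>(x, y). vector_derivative (\<lambda>s. f (x, s)) (at y within T))"

definition mixed_partial ::
    "real set \<Rightarrow> real set \<Rightarrow> (real \<times> real \<Rightarrow> real) \<Rightarrow> real \<times> real \<Rightarrow> real" where
  "mixed_partial S T f = partial_fst S (partial_snd T f)"

text \<open>
  The first conjunct is needed because \<^const>\<open>vector_derivative\<close> is an unspecified value where
  the derivative does not exist.
\<close>

definition mixed_partial_exists_on ::
    "real set \<Rightarrow> real set \<Rightarrow> (real \<times> real \<Rightarrow> real) \<Rightarrow> bool" where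
  "mixed_partial_exists_on S T f \<longleftrightarrow>
     partial_differentiable_snd_on S T f \<and>
     partial_differentiable_fst_on S T (partial_snd T f)"

end

theory Submission
  imports Defs
begin

text \<open>
  The quantity to be estimated is a tensor product.  For \<open>g\<close> on \<open>[p, q]\<close> consider the error of
  Simpson's rule, mean value minus \<open>(g p + 4 g ((p + q) / 2) + g q) / 6\<close>.  Taking this error in
  the second variable of \<open>f\<close>, and then in the first variable of the resulting function, and
  expanding, gives exactly the expression between the bars: the product of the two Simpson rules
  yields the weights \<open>1/36\<close>, \<open>4/36\<close> and \<open>16/36\<close> of the nine nodes, the product of the two means
  yields the double integral, and the two mixed products yield \<open>A\<close>.

  In one variable only a Lipschitz bound is required
  (\<open>abs_simpson_error_le\<close>): a \<open>K\<close>-Lipschitz function has error at most \<open>5/36 (q - p) K\<close>.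
  A bound \<open>M\<close> on the mixed derivative is, by the mean value theorem used once in each variable,
  a bound \<open>M \<bar>x' - x\<bar> \<bar>y' - y\<bar>\<close> on the second difference of \<open>f\<close> over a rectangle
  (\<open>abs_second_difference_le\<close>).  In other words, \<open>f (x', \<cdot>) - f (x, \<cdot>)\<close> is
  \<open>M \<bar>x' - x\<bar>\<close>-Lipschitz.  The error being linear, the Simpson error in \<open>y\<close> is therefore a
  \<open>5/36 (d - c) M\<close>-Lipschitz function of \<open>x\<close>, and the one-variable bound applies again, with
  \<open>(5/36)\<^sup>2 = 25/1296\<close>.

  Arguing through Lipschitz constants instead of Peano kernels and integrals of the derivative
  keeps the integrability of the mixed derivative and the exchange of the two integrations out of
  the proof.
\<close>

section \<open>Simpson's rule for Lipschitz functions\<close>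

lemma has_integral_abs_diff:
  fixes p m q :: real
  assumes "p \<le> m" "m \<le> q"
  shows "((\<lambda>x. \<bar>x - m\<bar>) has_integral ((m - p)\<^sup>2 + (q - m)\<^sup>2) / 2) {p..q}"
proof -
  have "((\<lambda>x. (x - m) * \<bar>x - m\<bar> / 2) has_vector_derivative \<bar>x - m\<bar>) (at x)"
    if "x \<noteq> m" for x
  proof -
    have "(abs has_real_derivative sgn (x - m)) (at (x - m))"
      using has_derivative_norm[of "x - m"] that
      unfolding has_field_derivative_def inner_real_def real_norm_def[abs_def]
      by (simp add: mult.commute[of _ "sgn (x - m)"])
    then have "((\<lambda>x. \<bar>x - m\<bar>) has_real_derivative sgn (x - m)) (at x)"
      using DERIV_chain2[of abs "sgn (x - m)" "\<lambda>x. x - m" x 1]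
        DERIV_diff[OF DERIV_ident DERIV_const] by fastforce
    then show ?thesis
      using that unfolding has_real_derivative_iff_has_vector_derivative[symmetric]
      by (auto intro!: derivative_eq_intros simp: field_simps sgn_if)
  qed
  then have "((\<lambda>x. \<bar>x - m\<bar>) has_integral
      ((q - m) * \<bar>q - m\<bar> / 2 - (p - m) * \<bar>p - m\<bar> / 2)) {p..q}"
    using assms
    by (intro fundamental_theorem_of_calculus_interior_strong[where S = "{m}"])
       (auto intro!: continuous_intros)
  also have "(q - m) * \<bar>q - m\<bar> / 2 - (p - m) * \<bar>p - m\<bar> / 2 = ((m - p)\<^sup>2 + (q - m)\<^sup>2) / 2"
    using assms by (simp add: power2_eq_square field_simps)
  finally show ?thesis .
qed

lemma abs_integral_minus_rectangle_le:
  fixes g :: "real \<Rightarrow> real"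
  assumes lip: "K-lipschitz_on {p..q} g" and "p \<le> m" "m \<le> q"
  shows "\<bar>integral {p..q} g - (q - p) * g m\<bar> \<le> K * (((m - p)\<^sup>2 + (q - m)\<^sup>2) / 2)"
proof -
  have int: "g integrable_on {p..q}"
    using lip by (intro integrable_continuous_real lipschitz_on_continuous_on)
  have "norm (integral {p..q} (\<lambda>x. g x - g m)) \<le> integral {p..q} (\<lambda>x. K * \<bar>x - m\<bar>)"
  proof (rule integral_norm_bound_integral)
    show "(\<lambda>x. g x - g m) integrable_on {p..q}"
      using int by (intro integrable_diff) auto
    show "(\<lambda>x. K * \<bar>x - m\<bar>) integrable_on {p..q}"
      by (intro integrable_continuous_real continuous_intros)
    show "norm (g x - g m) \<le> K * \<bar>x - m\<bar>" if "x \<in> {p..q}" for x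
      using lipschitz_onD[OF lip that, of m] assms by (simp add: dist_real_def)
  qed
  moreover have "integral {p..q} (\<lambda>x. g x - g m) = integral {p..q} g - (q - p) * g m"
    using int assms by (subst integral_diff) auto
  moreover have "integral {p..q} (\<lambda>x. K * \<bar>x - m\<bar>) = K * (((m - p)\<^sup>2 + (q - m)\<^sup>2) / 2)"
    using has_integral_mult_right[OF has_integral_abs_diff[OF assms(2,3)], of K]
    by (rule integral_unique)
  ultimately show ?thesis by (simp only: real_norm_def)
qed

definition simpson_error :: "real \<Rightarrow> real \<Rightarrow> (real \<Rightarrow> real) \<Rightarrow> real" where
  "simpson_error p q g = integral {p..q} g / (q - p) - (g p + 4 * g ((p + q) / 2) + g q) / 6"

lemma simpson_error_diff:
  assumes "g integrable_on {p..q}" "h integrable_on {p..q}"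
  shows "simpson_error p q (\<lambda>x. g x - h x) = simpson_error p q g - simpson_error p q h"
  using assms by (simp add: simpson_error_def integral_diff diff_divide_distrib add_divide_distrib)

text \<open>
  Cut \<open>[p, q]\<close> into three cells of lengths \<open>1/6\<close>, \<open>4/6\<close> and \<open>1/6\<close> of the whole, so that each
  Simpson node lies in the cell whose length is its weight.  Simpson's rule is then a Riemann sum,
  and its error is the sum of the errors of three rectangles.  With \<open>h = (q - p) / 6\<close> they are
  bounded by \<open>K h\<^sup>2 / 2\<close>, \<open>4 K h\<^sup>2\<close> and \<open>K h\<^sup>2 / 2\<close>.
\<close>

lemma abs_simpson_error_le:
  fixes g :: "real \<Rightarrow> real"
  assumes "p < q" and lip: "K-lipschitz_on {p..q} g"
  shows "\<bar>simpson_error p q g\<bar> \<le> 5 / 36 * (q - p) * K"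
proof -
  define h where "h = (q - p) / 6"
  have "6 * h = q - p"
    by (simp add: h_def diff_divide_distrib)
  with assms have h: "h > 0" and q: "q = p + 6 * h"
    by linarith+
  have mid: "(p + q) / 2 = p + 3 * h"
    by (simp add: q)
  have int: "g integrable_on {p..q}"
    using lip by (intro integrable_continuous_real lipschitz_on_continuous_on)
  have cells: "integral {p..q} g
      = integral {p..p + h} g + integral {p + h..p + 5 * h} g + integral {p + 5 * h..q} g"
    using h q int
    by (subst Henstock_Kurzweil_Integration.integral_combine
          [of p "p + h" "p + 5 * h" g, OF _ _ integrable_on_subinterval[OF int]])
       (auto simp: Henstock_Kurzweil_Integration.integral_combine)
  have "\<bar>integral {p..p + h} g - h * g p\<bar> \<le> K * (h\<^sup>2 / 2)"
    using abs_integral_minus_rectangle_le[OF lipschitz_on_subset[OF lip], of p "p + h" p] h q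
    by simp
  moreover have "\<bar>integral {p + h..p + 5 * h} g - 4 * h * g (p + 3 * h)\<bar> \<le> K * (4 * h\<^sup>2)"
    using abs_integral_minus_rectangle_le
        [OF lipschitz_on_subset[OF lip], of "p + h" "p + 5 * h" "p + 3 * h"] h q
    by (simp add: power2_eq_square algebra_simps)
  moreover have "\<bar>integral {p + 5 * h..q} g - h * g q\<bar> \<le> K * (h\<^sup>2 / 2)"
    using abs_integral_minus_rectangle_le[OF lipschitz_on_subset[OF lip], of "p + 5 * h" q q] h q
    by (simp add: power2_eq_square algebra_simps)
  moreover have "K * (5 * h\<^sup>2) = K * (h\<^sup>2 / 2) + K * (4 * h\<^sup>2) + K * (h\<^sup>2 / 2)"
    by (simp add: algebra_simps)
  ultimately have "\<bar>integral {p..q} g - (h * g p + 4 * h * g (p + 3 * h) + h * g q)\<bar>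
      \<le> K * (5 * h\<^sup>2)"
    unfolding cells by linarith
  moreover have "integral {p..q} g - (h * g p + 4 * h * g (p + 3 * h) + h * g q)
      = 6 * h * simpson_error p q g"
    unfolding simpson_error_def mid using h by (simp add: q field_simps)
  ultimately have "(6 * h) * \<bar>simpson_error p q g\<bar> \<le> (6 * h) * (5 / 6 * h * K)"
    using h by (simp add: abs_mult power2_eq_square algebra_simps)
  then have "\<bar>simpson_error p q g\<bar> \<le> 5 / 6 * h * K"
    using h by (simp only: mult_le_cancel_left_pos)
  then show ?thesis
    by (simp add: h_def)
qed

section \<open>Second differences and the mixed derivative\<close>

text \<open>
  The mean value theorem is applied first to \<open>s \<mapsto> f (x', s) - f (x, s)\<close>, then to \<open>\<partial>f/\<partial>s\<close> as a
  function of the first variable.  Both intermediate points are interior, which is why a bound on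
  the open rectangle suffices although the derivatives at the boundary are one-sided.
\<close>

lemma abs_second_difference_le_ordered:
  assumes mixed: "mixed_partial_exists_on {a..b} {c..d} f"
    and bound: "\<And>p. p \<in> {a<..<b} \<times> {c<..<d} \<Longrightarrow> \<bar>mixed_partial {a..b} {c..d} f p\<bar> \<le> M"
    and x: "a \<le> x" "x < x'" "x' \<le> b" and y: "c \<le> y" "y < y'" "y' \<le> d"
  shows "\<bar>(f (x', y') - f (x, y')) - (f (x', y) - f (x, y))\<bar> \<le> M * (x' - x) * (y' - y)"
proof -
  have snd: "((\<lambda>s. f (t, s)) has_derivative (\<lambda>u. u * partial_snd {c..d} f (t, s)))
      (at s within {y..y'})" if "t \<in> {a..b}" "s \<in> {y..y'}" for t s
  proof -
    have "(\<lambda>s. f (t, s)) differentiable (at s within {c..d})"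
      using mixed that y
      by (auto simp: mixed_partial_exists_on_def partial_differentiable_snd_on_def)
    then have "((\<lambda>s. f (t, s)) has_vector_derivative partial_snd {c..d} f (t, s))
        (at s within {c..d})"
      by (simp add: vector_derivative_works partial_snd_def)
    then show ?thesis
      using y by (auto simp: has_vector_derivative_def intro: has_derivative_subset)
  qed
  have fst: "((\<lambda>t. partial_snd {c..d} f (t, s)) has_derivative
      (\<lambda>u. u * mixed_partial {a..b} {c..d} f (t, s))) (at t within {x..x'})"
    if "t \<in> {x..x'}" "s \<in> {c..d}" for t s
  proof -
    have "(\<lambda>t. partial_snd {c..d} f (t, s)) differentiable (at t within {a..b})"
      using mixed that x
      by (auto simp: mixed_partial_exists_on_def partial_differentiable_fst_on_def)
    then have "((\<lambda>t. partial_snd {c..d} f (t, s)) has_vector_derivative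
        mixed_partial {a..b} {c..d} f (t, s)) (at t within {a..b})"
      by (simp add: vector_derivative_works mixed_partial_def partial_fst_def)
    then show ?thesis
      using x by (auto simp: has_vector_derivative_def intro: has_derivative_subset)
  qed
  have "\<exists>s\<in>{y<..<y'}. (f (x', y') - f (x, y')) - (f (x', y) - f (x, y))
      = (y' - y) * partial_snd {c..d} f (x', s) - (y' - y) * partial_snd {c..d} f (x, s)"
    using y x by (intro mvt_simple has_derivative_diff snd) auto
  then obtain s where s: "s \<in> {y<..<y'}"
    and eq_s: "(f (x', y') - f (x, y')) - (f (x', y) - f (x, y))
      = (y' - y) * (partial_snd {c..d} f (x', s) - partial_snd {c..d} f (x, s))"
    by (auto simp: right_diff_distrib)
  have "\<exists>t\<in>{x<..<x'}. partial_snd {c..d} f (x', s) - partial_snd {c..d} f (x, s)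
      = (x' - x) * mixed_partial {a..b} {c..d} f (t, s)"
    using x y s by (intro mvt_simple fst) auto
  then obtain t where t: "t \<in> {x<..<x'}"
    and eq_t: "partial_snd {c..d} f (x', s) - partial_snd {c..d} f (x, s)
      = (x' - x) * mixed_partial {a..b} {c..d} f (t, s)"
    by blast
  have "\<bar>(f (x', y') - f (x, y')) - (f (x', y) - f (x, y))\<bar>
      = (x' - x) * (y' - y) * \<bar>mixed_partial {a..b} {c..d} f (t, s)\<bar>"
    unfolding eq_s eq_t using x y by (simp add: abs_mult)
  also have "\<dots> \<le> (x' - x) * (y' - y) * M"
    using x y s t by (intro mult_left_mono bound) auto
  finally show ?thesis
    by (simp add: mult_ac)
qed

lemma abs_second_difference_le:
  assumes mixed: "mixed_partial_exists_on {a..b} {c..d} f"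
    and bound: "\<And>p. p \<in> {a<..<b} \<times> {c<..<d} \<Longrightarrow> \<bar>mixed_partial {a..b} {c..d} f p\<bar> \<le> M"
    and "x \<in> {a..b}" "x' \<in> {a..b}" "y \<in> {c..d}" "y' \<in> {c..d}"
  shows "\<bar>(f (x', y') - f (x, y')) - (f (x', y) - f (x, y))\<bar> \<le> M * \<bar>x' - x\<bar> * \<bar>y' - y\<bar>"
proof -
  note ordered = abs_second_difference_le_ordered[OF mixed bound]
  consider "x = x' \<or> y = y'" | "x < x'" "y < y'" | "x < x'" "y' < y"
    | "x' < x" "y < y'" | "x' < x" "y' < y"
    by linarith
  then show ?thesis
  proof cases
    case 1
    then show ?thesis by auto
  next
    case 2
    then show ?thesis using ordered[of x x' y y'] assms(3-) by simp
  next
    case 3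
    then show ?thesis using ordered[of x x' y' y] assms(3-) by simp
  next
    case 4
    then show ?thesis using ordered[of x' x y y'] assms(3-) by simp
  next
    case 5
    then show ?thesis using ordered[of x' x y' y] assms(3-) by simp
  qed
qed

section \<open>The product of two Simpson errors\<close>

theorem theorem4:
  fixes a b c d :: real and f :: "real \<times> real \<Rightarrow> real"
  assumes "a < b" and "c < d"
    and "partial_differentiable_on {a..b} {c..d} f"
    and "mixed_partial_exists_on {a..b} {c..d} f"
    and "bdd_above ((\<lambda>p. \<bar>mixed_partial {a..b} {c..d} f p\<bar>) ` ({a<..<b} \<times> {c<..<d}))"
  shows
    "\<bar>(f (a, (c + d) / 2) + f (b, (c + d) / 2) + 4 * f ((a + b) / 2, (c + d) / 2)
         + f ((a + b) / 2, c) + f ((a + b) / 2, d)) / 9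
      + (f (a, c) + f (b, c) + f (a, d) + f (b, d)) / 36
      + 1 / ((b - a) * (d - c)) * integral {a..b} (\<lambda>x. integral {c..d} (\<lambda>y. f (x, y)))
      - (1 / (6 * (b - a)) *
           integral {a..b} (\<lambda>x. f (x, c) + 4 * f (x, (c + d) / 2) + f (x, d))
         + 1 / (6 * (d - c)) *
           integral {c..d} (\<lambda>y. f (a, y) + 4 * f ((a + b) / 2, y) + f (b, y)))\<bar>
     \<le> 25 * (b - a) * (d - c) / 1296 *
        (SUP p \<in> {a<..<b} \<times> {c<..<d}. \<bar>mixed_partial {a..b} {c..d} f p\<bar>)"
proof -
  define M where "M = (SUP p \<in> {a<..<b} \<times> {c<..<d}. \<bar>mixed_partial {a..b} {c..d} f p\<bar>)"
  define m where "m = (a + b) / 2"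
  define n where "n = (c + d) / 2"
  define E where "E x = simpson_error c d (\<lambda>y. f (x, y))" for x
  define I where "I x = integral {c..d} (\<lambda>y. f (x, y))" for x
  define S where "S x = f (x, c) + 4 * f (x, n) + f (x, d)" for x
  have m: "m \<in> {a..b}" and n: "n \<in> {c..d}"
    using assms(1,2) by (auto simp: m_def n_def)
  have bound: "\<bar>mixed_partial {a..b} {c..d} f p\<bar> \<le> M" if "p \<in> {a<..<b} \<times> {c<..<d}" for p
    unfolding M_def using that assms(5) by (rule cSUP_upper)
  have "M \<ge> 0"
    using bound[of "(m, n)"] assms(1,2) by (auto simp: m_def n_def)
  have cont_fst: "continuous_on {a..b} (\<lambda>x. f (x, y))" if "y \<in> {c..d}" for y
    using assms(3) that
    by (intro differentiable_imp_continuous_on)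
       (auto simp: partial_differentiable_on_def partial_differentiable_fst_on_def
          differentiable_on_def)
  have cont_snd: "continuous_on {c..d} (\<lambda>y. f (x, y))" if "x \<in> {a..b}" for x
    using assms(3) that
    by (intro differentiable_imp_continuous_on)
       (auto simp: partial_differentiable_on_def partial_differentiable_snd_on_def
          differentiable_on_def)
  note int_snd = integrable_continuous_real[OF cont_snd]

  \<comment> \<open>The difference of two values of \<open>E\<close> is the Simpson error of \<open>f (x', \<cdot>) - f (x, \<cdot>)\<close>,
    whose Lipschitz constant is controlled by the second differences of \<open>f\<close>.\<close>
  have lip: "(5 / 36 * (d - c) * M)-lipschitz_on {a..b} E"
  proof (rule lipschitz_onI)
    fix x' x assume x: "x' \<in> {a..b}" "x \<in> {a..b}"
    have "(M * \<bar>x' - x\<bar>)-lipschitz_on {c..d} (\<lambda>y. f (x', y) - f (x, y))"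
      using abs_second_difference_le[OF assms(4) bound x(2,1)] \<open>M \<ge> 0\<close>
      by (intro lipschitz_onI) (auto simp: dist_real_def)
    then have "\<bar>simpson_error c d (\<lambda>y. f (x', y) - f (x, y))\<bar> \<le> 5 / 36 * (d - c) * (M * \<bar>x' - x\<bar>)"
      using assms(2) by (rule abs_simpson_error_le[rotated])
    then show "dist (E x') (E x) \<le> 5 / 36 * (d - c) * M * dist x' x"
      using x by (simp add: simpson_error_diff int_snd E_def dist_real_def mult.assoc)
  qed (use \<open>M \<ge> 0\<close> assms(2) in auto)

  have S_int: "S integrable_on {a..b}"
    unfolding S_def using assms(2) n
    by (intro integrable_continuous_real continuous_intros cont_fst) auto
  have E_int: "E integrable_on {a..b}"
    using lip by (intro integrable_continuous_real lipschitz_on_continuous_on)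
  have E_eq: "E x = I x / (d - c) - S x / 6" for x
    by (simp add: E_def I_def S_def n_def simpson_error_def)
  \<comment> \<open>The outer integrability of the inner integral is inherited from \<open>E\<close> and \<open>S\<close>.\<close>
  have "(\<lambda>x. (d - c) * (E x + S x / 6)) integrable_on {a..b}"
    using E_int S_int by (intro integrable_on_mult_right integrable_add integrable_on_divide)
  moreover have "(\<lambda>x. (d - c) * (E x + S x / 6)) = I"
    using assms(2) by (auto simp: E_eq)
  ultimately have I_int: "I integrable_on {a..b}"
    by simp
  have E_integral: "integral {a..b} E = integral {a..b} I / (d - c) - integral {a..b} S / 6"
  proof -
    have "E = (\<lambda>x. I x / (d - c) - S x / 6)"
      by (rule ext) (rule E_eq)
    moreover have "integral {a..b} (\<lambda>x. I x / (d - c) - S x / 6)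
        = integral {a..b} I / (d - c) - integral {a..b} S / 6"
      using integral_diff[OF integrable_on_divide[OF I_int] integrable_on_divide[OF S_int]]
      by simp
    ultimately show ?thesis
      by (simp only:)
  qed
  have row: "integral {c..d} (\<lambda>y. f (a, y) + 4 * f (m, y) + f (b, y)) = I a + 4 * I m + I b"
    unfolding I_def using int_snd[of a] int_snd[OF m] int_snd[of b] assms(1)
    by (simp add: integral_add integrable_add integrable_on_mult_right)

  have "simpson_error a b E
      = (f (a, n) + f (b, n) + 4 * f (m, n) + f (m, c) + f (m, d)) / 9
        + (f (a, c) + f (b, c) + f (a, d) + f (b, d)) / 36
        + 1 / ((b - a) * (d - c)) * integral {a..b} I
        - (1 / (6 * (b - a)) * integral {a..b} S
           + 1 / (6 * (d - c)) * (I a + 4 * I m + I b))"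
  proof -
    \<comment> \<open>With the reciprocals as atoms both sides are polynomials, and the identity is expansion.\<close>
    define u v where "u = inverse (b - a)" and "v = inverse (d - c)"
    have expanded: "simpson_error a b E = (integral {a..b} I * v - integral {a..b} S / 6) * u
        - ((I a * v - S a / 6) + 4 * (I m * v - S m / 6) + (I b * v - S b / 6)) / 6"
      unfolding simpson_error_def E_integral m_def[symmetric] E_eq u_def v_def
      by (simp only: divide_inverse)
    have uv: "1 / ((b - a) * (d - c)) = u * v" "1 / (6 * (b - a)) = u / 6"
      "1 / (6 * (d - c)) = v / 6"
      by (simp_all only: u_def v_def divide_inverse inverse_mult_distrib mult_1_left mult.commute)
    show ?thesis
      unfolding expanded uv by (simp add: S_def algebra_simps add_divide_distrib diff_divide_distrib)
  qed
  moreover have "\<bar>simpson_error a b E\<bar> \<le> 25 * (b - a) * (d - c) / 1296 * M"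
    using abs_simpson_error_le[OF assms(1) lip] by (simp add: algebra_simps)
  ultimately show ?thesis
    unfolding row[symmetric] by (simp only: I_def[abs_def] S_def[abs_def] m_def n_def M_def)
qed

end
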